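(* Let $\Pi=\mathbb{R}/\mathbb{Z}$ be the circle. Let $a\in C^2(\Pi)$ with $a>0$ and $b\in C^1(\Pi)$. Assume that $b$ changes sign on $\Pi$ (it takes both positive and negative values), that $b$ vanishes at only finitely many points $x_1,\dots,x_n$, and that each zero $x_i$ of $b$ is either of finite order $m_i\ge1$ or flat. Let $\mu$ be a probability measure on $\Pi$ such that $\operatorname{supp}\mu\not\subset\{x_1,\dots,x_n\}$. Then $J(\mu)=+\infty$.
   Context: A zero $x_i$ of $b$ is of finite order $m_i\ge1$ if $b$ is $C^{m_i}$ in a neighborhood of $x_i$, $b(x_i)=\dots=b^{(m_i-1)}(x_i)=0$ and $b^{(m_i)}(x_i)\ne0$. It is flat if $b$ is $C^\infty$ in a neighborhood of $x_i$ and $b^{(k)}(x_i)=0$ for all $k\in\mathbb{N}$. For $c\in C^0(\Pi)$ and $\epsilon>0$, let $\lambda_\epsilon^c$ be the principal eigenvalue (the eigenvalue with maximal real part) of the operator $u\mapsto\epsilon\,a\,u''+b\,u'+c\,u$ on $\Pi$. Let $\Lambda(c):=\lim_{\epsilon\to0}\lambda_\epsilon^c$ (this limit exists under the present assumptions). For a probability measure $\mu$ on $\Pi$, $$J(\mu):=\sup_{c\in C^0(\Pi)}\Bigl\{\int_\Pi c\,d\mu-\Lambda(c)\Bigr\}.$$ *)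

theory Defs
  imports "HOL-Probability.Probability"
begin

section \<open>The circle $\mathbb{R}/\mathbb{Z}$\<close>

quotient_type circle = real / "\<lambda>x y :: real. x - y \<in> \<int>"
  morphisms rep_circle to_circle
proof (rule equivpI)
  show "reflp (\<lambda>x y :: real. x - y \<in> \<int>)"
    by (simp add: reflp_def)
  show "symp (\<lambda>x y :: real. x - y \<in> \<int>)"
    by (metis (mono_tags, lifting) Ints_minus minus_diff_eq sympI)
  show "transp (\<lambda>x y :: real. x - y \<in> \<int>)"
  proof (rule transpI)
    fix x y z :: real
    assume "x - y \<in> \<int>" "y - z \<in> \<int>"
    then have "(x - y) + (y - z) \<in> \<int>" by (rule Ints_add)
    then show "x - z \<in> \<int>" by simp
  qed
qed

lemma to_circle_eq_iff: "to_circle x = to_circle y \<longleftrightarrow> x - y \<in> \<int>"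
  by (rule circle.abs_eq_iff)

lemma to_circle_rep_circle [simp]: "to_circle (rep_circle p) = p"
  by (rule Quotient_abs_rep[OF Quotient_circle])

text \<open>The topology is the quotient topology; the sigma-algebra on the circle is
  \<^term>\<open>borel\<close> for this topology.\<close>

instantiation circle :: topological_space
begin

definition open_circle :: "circle set \<Rightarrow> bool" where
  "open_circle U \<longleftrightarrow> open (to_circle -` U)"

instance
  by standard (auto simp: open_circle_def vimage_Union)

end

lemma continuous_on_circle_iff:
  fixes f :: "circle \<Rightarrow> 'a::topological_space"
  shows "continuous_on UNIV f \<longleftrightarrow> continuous_on UNIV (\<lambda>t. f (to_circle t))"
  by (simp add: continuous_on_open_vimage open_circle_def vimage_def)

section \<open>Calculus on the circle\<close>

text \<open>Functions on the circle are differentiated by differentiating their 1-periodic lift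
  \<^term>\<open>\<lambda>t. f (to_circle t)\<close> to the real line; the choice of the representative is
  immaterial, see \<open>circle_deriv_to_circle\<close> and \<open>circle_differentiable_to_circle\<close>.\<close>

definition circle_differentiable ::
    "(circle \<Rightarrow> 'a::real_normed_vector) \<Rightarrow> circle \<Rightarrow> bool" where
  "circle_differentiable f p \<longleftrightarrow> (\<lambda>t. f (to_circle t)) differentiable (at (rep_circle p))"

definition circle_deriv ::
    "(circle \<Rightarrow> 'a::real_normed_vector) \<Rightarrow> circle \<Rightarrow> 'a" where
  "circle_deriv f p = vector_derivative (\<lambda>t. f (to_circle t)) (at (rep_circle p))"

lemma has_vector_derivative_lift_cong:
  fixes f :: "circle \<Rightarrow> 'a::real_normed_vector"
  assumes "to_circle s = to_circle t"
    and "((\<lambda>r. f (to_circle r)) has_vector_derivative d) (at s)"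
  shows "((\<lambda>r. f (to_circle r)) has_vector_derivative d) (at t)"
proof -
  define k where "k = s - t"
  have k: "k \<in> \<int>" using assms(1) by (simp add: k_def to_circle_eq_iff)
  have "((\<lambda>r. f (to_circle r)) \<circ> (\<lambda>r. r + k) has_vector_derivative 1 *\<^sub>R d) (at t)"
    by (rule vector_diff_chain_at) (use assms(2) in \<open>auto intro!: derivative_eq_intros simp: k_def\<close>)
  moreover have "(\<lambda>r. f (to_circle r)) \<circ> (\<lambda>r. r + k) = (\<lambda>r. f (to_circle r))"
    using k by (auto simp: fun_eq_iff to_circle_eq_iff intro!: arg_cong[where f = f])
  ultimately show ?thesis by simp
qed

lemma has_vector_derivative_lift_rep_iff:
  fixes f :: "circle \<Rightarrow> 'a::real_normed_vector"
  shows "((\<lambda>r. f (to_circle r)) has_vector_derivative d) (at (rep_circle (to_circle t))) \<longleftrightarrow>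
    ((\<lambda>r. f (to_circle r)) has_vector_derivative d) (at t)"
  by (metis has_vector_derivative_lift_cong to_circle_rep_circle)

lemma circle_deriv_to_circle:
  "circle_deriv f (to_circle t) = vector_derivative (\<lambda>r. f (to_circle r)) (at t)"
  unfolding circle_deriv_def vector_derivative_def has_vector_derivative_lift_rep_iff ..

lemma circle_differentiable_to_circle:
  "circle_differentiable f (to_circle t) \<longleftrightarrow> (\<lambda>r. f (to_circle r)) differentiable (at t)"
  unfolding circle_differentiable_def
  by (metis has_vector_derivative_lift_rep_iff vector_derivative_works
      differentiableI_vector)

text \<open>Intended for open \<open>S\<close>: the derivatives are two-sided, not relative to \<open>S\<close>.\<close>

definition C_k_on :: "nat \<Rightarrow> (circle \<Rightarrow> 'a::real_normed_vector) \<Rightarrow> circle set \<Rightarrow> bool" where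
  "C_k_on k f S \<longleftrightarrow>
     (\<forall>j<k. \<forall>p\<in>S. circle_differentiable ((circle_deriv ^^ j) f) p) \<and>
     continuous_on S ((circle_deriv ^^ k) f)"

definition zero_of_order :: "(circle \<Rightarrow> real) \<Rightarrow> circle \<Rightarrow> nat \<Rightarrow> bool" where
  "zero_of_order b x m \<longleftrightarrow>
     m \<ge> 1 \<and>
     (\<exists>N. open N \<and> x \<in> N \<and> C_k_on m b N) \<and>
     (\<forall>j<m. (circle_deriv ^^ j) b x = 0) \<and>
     (circle_deriv ^^ m) b x \<noteq> 0"

definition flat_zero :: "(circle \<Rightarrow> real) \<Rightarrow> circle \<Rightarrow> bool" where
  "flat_zero b x \<longleftrightarrow>
     (\<exists>N. open N \<and> x \<in> N \<and> (\<forall>k. C_k_on k b N)) \<and>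
     (\<forall>k. (circle_deriv ^^ k) b x = 0)"

section \<open>Principal eigenvalue and the functional J\<close>

text \<open>The coefficients are real, but eigenvalues and eigenfunctions are complex.\<close>

definition elliptic_op ::
    "(circle \<Rightarrow> real) \<Rightarrow> (circle \<Rightarrow> real) \<Rightarrow> (circle \<Rightarrow> real) \<Rightarrow> real \<Rightarrow>
     (circle \<Rightarrow> complex) \<Rightarrow> circle \<Rightarrow> complex" where
  "elliptic_op a b c \<epsilon> u x =
     of_real (\<epsilon> * a x) * (circle_deriv ^^ 2) u x + of_real (b x) * circle_deriv u x
     + of_real (c x) * u x"

definition is_eigenvalue ::
    "(circle \<Rightarrow> real) \<Rightarrow> (circle \<Rightarrow> real) \<Rightarrow> (circle \<Rightarrow> real) \<Rightarrow> real \<Rightarrow> complex \<Rightarrow> bool" where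
  "is_eigenvalue a b c \<epsilon> z \<longleftrightarrow>
     (\<exists>u. C_k_on 2 u UNIV \<and> (\<exists>x. u x \<noteq> 0) \<and> (\<forall>x. elliptic_op a b c \<epsilon> u x = z * u x))"

text \<open>The eigenvalue with maximal real part is real (Krein--Rutman), so it is taken in the reals.\<close>

definition principal_eigenvalue ::
    "(circle \<Rightarrow> real) \<Rightarrow> (circle \<Rightarrow> real) \<Rightarrow> (circle \<Rightarrow> real) \<Rightarrow> real \<Rightarrow> real" where
  "principal_eigenvalue a b c \<epsilon> =
     (THE r. is_eigenvalue a b c \<epsilon> (of_real r) \<and>
             (\<forall>z. is_eigenvalue a b c \<epsilon> z \<longrightarrow> Re z \<le> r))"

definition Lambda_lim ::
    "(circle \<Rightarrow> real) \<Rightarrow> (circle \<Rightarrow> real) \<Rightarrow> (circle \<Rightarrow> real) \<Rightarrow> real" where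
  "Lambda_lim a b c = Lim (at_right 0) (\<lambda>\<epsilon>. principal_eigenvalue a b c \<epsilon>)"

definition J_functional ::
    "(circle \<Rightarrow> real) \<Rightarrow> (circle \<Rightarrow> real) \<Rightarrow> circle measure \<Rightarrow> ereal" where
  "J_functional a b \<mu> =
     (SUP c\<in>{c. continuous_on UNIV c}. ereal ((\<integral>x. c x \<partial>\<mu>) - Lambda_lim a b c))"

definition measure_support :: "'a::topological_space measure \<Rightarrow> 'a set" where
  "measure_support \<mu> = {x. \<forall>U. open U \<longrightarrow> x \<in> U \<longrightarrow> emeasure \<mu> U > 0}"

end

theory Submission
  imports Defs
begin

text \<open>If \<open>c = - b f'\<close> for a \<open>C\<^sup>2\<close> function \<open>f\<close>, then \<open>e\<^sup>f\<close> is an approximate eigenfunction: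
  comparing an eigenfunction with it at the maximum of \<open>|u| e\<^sup>-\<^sup>f\<close> shows that every
  eigenvalue has real part at most \<open>\<epsilon> max a (f'' + f'\<^sup>2)\<close>, which gives a bound on \<open>\<Lambda>(c)\<close>
  that does not change when \<open>f\<close> is rescaled. Hence \<open>J(\<mu>) = \<infinity>\<close> as soon as
  \<open>\<integral> b f' d\<mu> > 0\<close> for some \<open>f\<close>. Such an \<open>f\<close> exists since \<open>b\<close> changes sign: let \<open>f'\<close> be a
  bump where \<open>b > 0\<close> minus a translate of it where \<open>b < 0\<close>, one of the two being centred at a
  point of the support of \<open>\<mu>\<close>; then \<open>b f'\<close> is nonnegative and positive at this point.\<close>

section \<open>Compactness of the circle and calculus through periodic lifts\<close>

lemma to_circle_of_int [simp]: "to_circle (t + of_int n) = to_circle t"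
  by (simp add: to_circle_eq_iff)

lemma continuous_on_to_circle: "continuous_on A to_circle"
  by (rule continuous_on_subset[of UNIV])
    (auto simp: continuous_on_open_vimage open_circle_def)

lemma compact_UNIV_circle: "compact (UNIV :: circle set)"
proof -
  have "p \<in> to_circle ` {0..1}" for p
  proof -
    have "to_circle (frac (rep_circle p)) = p"
      using to_circle_of_int[of "rep_circle p" "- \<lfloor>rep_circle p\<rfloor>"] by (simp add: frac_def)
    moreover have "frac (rep_circle p) \<in> {0..1}"
      by (simp add: less_imp_le frac_lt_1)
    ultimately show ?thesis by (metis imageI)
  qed
  then have "UNIV = to_circle ` {0..1::real}" by blast
  then show ?thesis
    by (metis compact_continuous_image continuous_on_to_circle compact_Icc)
qed

lemma circle_deriv_unique:
  assumes "((\<lambda>t. f (to_circle t)) has_vector_derivative d) (at t)"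
  shows "circle_deriv f (to_circle t) = d"
  using assms by (simp add: circle_deriv_to_circle vector_derivative_at)

lemma C_k_on_has_vector_derivative:
  assumes "C_k_on k f UNIV" "j < k"
  shows "((\<lambda>t. (circle_deriv ^^ j) f (to_circle t)) has_vector_derivative
           (circle_deriv ^^ Suc j) f (to_circle t)) (at t)"
proof -
  have "circle_differentiable ((circle_deriv ^^ j) f) (to_circle t)"
    using assms by (simp add: C_k_on_def)
  then show ?thesis
    by (simp add: circle_differentiable_to_circle circle_deriv_to_circle vector_derivative_works)
qed

text \<open>\<open>C_k_on\<close> records continuity only at the top order \<open>k\<close>; below
  it, the derivatives are continuous because their lifts are differentiable.\<close>

lemma C_k_on_imp_continuous_on:
  assumes "C_k_on k f UNIV" "j \<le> k"
  shows "continuous_on UNIV ((circle_deriv ^^ j) f)"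
proof (cases "j = k")
  case True
  then show ?thesis using assms by (simp add: C_k_on_def)
next
  case False
  then have "isCont (\<lambda>t. (circle_deriv ^^ j) f (to_circle t)) t" for t
    using C_k_on_has_vector_derivative[OF assms(1), of j t] assms(2)
      has_vector_derivative_continuous by fastforce
  then show ?thesis
    by (simp add: continuous_on_circle_iff continuous_at_imp_continuous_on)
qed

text \<open>Reduces regularity on the circle to ordinary calculus for the lift. The functions
  \<open>f'\<close> and \<open>f''\<close> live on the real line and inherit their periodicity from
  the lift.\<close>

lemma C_2_onI:
  assumes "\<And>t. ((\<lambda>t. f (to_circle t)) has_vector_derivative f' t) (at t)"
    and "\<And>t. (f' has_vector_derivative f'' t) (at t)"
    and "continuous_on UNIV f''"
  shows "C_k_on 2 f UNIV" and "\<And>t. circle_deriv f (to_circle t) = f' t"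
    and "\<And>t. (circle_deriv ^^ 2) f (to_circle t) = f'' t"
proof -
  show 1: "circle_deriv f (to_circle t) = f' t" for t
    by (rule circle_deriv_unique) (rule assms)
  have d: "((\<lambda>t. circle_deriv f (to_circle t)) has_vector_derivative f'' t) (at t)" for t
    by (simp add: 1 assms)
  show 2: "(circle_deriv ^^ 2) f (to_circle t) = f'' t" for t
    using circle_deriv_unique[OF d] by (simp add: numeral_2_eq_2)
  have "circle_differentiable ((circle_deriv ^^ j) f) p" if "j < 2" for j p
  proof -
    obtain t where p: "p = to_circle t" by (metis to_circle_rep_circle)
    have "j = 0 \<or> j = 1" using that by linarith
    then show ?thesis
      using assms(1)[of t] d[of t]
      by (auto simp: p circle_differentiable_to_circle intro: differentiableI_vector)
  qed
  then show "C_k_on 2 f UNIV"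
    using assms(3) by (simp add: C_k_on_def continuous_on_circle_iff 2)
qed

lemma C_2_on_cmult:
  fixes f :: "circle \<Rightarrow> real"
  assumes "C_k_on 2 f UNIV"
  shows "C_k_on 2 (\<lambda>p. k * f p) UNIV"
    and "circle_deriv (\<lambda>p. k * f p) (to_circle t) = k * circle_deriv f (to_circle t)"
proof -
  have 0: "((\<lambda>t. f (to_circle t)) has_vector_derivative circle_deriv f (to_circle t)) (at t)" for t
    using C_k_on_has_vector_derivative[OF assms, of 0] by simp
  have 1: "((\<lambda>t. circle_deriv f (to_circle t)) has_vector_derivative
      (circle_deriv ^^ 2) f (to_circle t)) (at t)" for t
    using C_k_on_has_vector_derivative[OF assms, of 1] by (simp add: numeral_2_eq_2)
  have c: "continuous_on UNIV (\<lambda>t. k * (circle_deriv ^^ 2) f (to_circle t))"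
    using C_k_on_imp_continuous_on[OF assms, of 2]
    by (auto simp: continuous_on_circle_iff intro!: continuous_intros)
  note * = C_2_onI[of "\<lambda>p. k * f p", OF has_vector_derivative_mult_right[OF 0]
      has_vector_derivative_mult_right[OF 1] c]
  show "C_k_on 2 (\<lambda>p. k * f p) UNIV"
    and "circle_deriv (\<lambda>p. k * f p) (to_circle t) = k * circle_deriv f (to_circle t)"
    using * by auto
qed

section \<open>Maximum principle and the bound on eigenvalues\<close>

text \<open>If \<open>d > 0\<close>, then \<open>g'\<close>, which vanishes at \<open>s\<close>, is
  positive just to the right of \<open>s\<close>, and the mean value theorem yields a value of
  \<open>g\<close> above the maximum.\<close>

lemma derivatives_at_max:
  fixes g g' :: "real \<Rightarrow> real"
  assumes g: "\<And>t. (g has_real_derivative g' t) (at t)"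
    and g': "(g' has_real_derivative d) (at s)"
    and max: "\<And>t. g t \<le> g s"
  shows "g' s = 0" and "d \<le> 0"
proof -
  show 0: "g' s = 0"
    by (rule DERIV_local_max[OF g zero_less_one]) (use max in auto)
  show "d \<le> 0"
  proof (rule ccontr)
    assume "\<not> d \<le> 0"
    then obtain \<delta> where \<delta>: "\<delta> > 0" "\<And>h. 0 < h \<Longrightarrow> h < \<delta> \<Longrightarrow> g' s < g' (s + h)"
      using DERIV_pos_inc_right[OF g'] by force
    have "s < s + \<delta> / 2" using \<delta> by simp
    then obtain z where z: "s < z" "z < s + \<delta> / 2" "g (s + \<delta> / 2) - g s = (\<delta> / 2) * g' z"
      using MVT2[of s "s + \<delta> / 2" g g'] g by auto
    have "g' z > 0" using \<delta>(2)[of "z - s"] z 0 \<delta>(1) by simp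
    then have "(\<delta> / 2) * g' z > 0" using \<delta>(1) by simp
    with z(3) max[of "s + \<delta> / 2"] show False by linarith
  qed
qed

text \<open>With \<open>M\<close> the maximum of \<open>|u| e\<^sup>-\<^sup>f\<close> and a suitable unimodular \<open>\<kappa>\<close>, the function
  \<open>Re (\<kappa> u) - M e\<^sup>f\<close> has maximum 0, at which its derivatives are controlled.\<close>

lemma eigenvalue_Re_le:
  fixes a b c f :: "circle \<Rightarrow> real"
  assumes a: "\<And>p. a p > 0" and \<epsilon>: "\<epsilon> > 0"
    and f: "C_k_on 2 f UNIV"
    and c: "\<And>p. c p = - b p * circle_deriv f p"
    and K: "\<And>p. a p * ((circle_deriv ^^ 2) f p + (circle_deriv f p)\<^sup>2) \<le> K"
    and z: "is_eigenvalue a b c \<epsilon> z"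
  shows "Re z \<le> \<epsilon> * K"
proof -
  obtain u where u: "C_k_on 2 u UNIV" and nz: "\<exists>x. u x \<noteq> 0"
    and eq: "\<And>x. elliptic_op a b c \<epsilon> u x = z * u x"
    using z unfolding is_eigenvalue_def by blast
  define w where "w p = cmod (u p) * exp (- f p)" for p
  have "continuous_on UNIV u" "continuous_on UNIV f"
    using C_k_on_imp_continuous_on[OF u, of 0] C_k_on_imp_continuous_on[OF f, of 0] by auto
  then have "continuous_on UNIV w"
    unfolding w_def by (intro continuous_intros)
  then obtain p where p: "\<And>q. w q \<le> w p"
    using continuous_attains_sup[OF compact_UNIV_circle] by auto
  obtain s where s: "p = to_circle s" by (metis to_circle_rep_circle)
  define M where "M = w p"
  have "M > 0"
  proof -
    obtain x where "u x \<noteq> 0" using nz by blast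
    then have "w x > 0" by (simp add: w_def)
    then show ?thesis using p[of x] by (simp add: M_def)
  qed
  have le: "cmod (u q) \<le> M * exp (f q)" for q
    using p[of q] by (simp add: w_def M_def exp_minus field_simps)
  have Mp: "M * exp (f p) = cmod (u p)"
    by (simp add: M_def w_def exp_minus)
  \<comment> \<open>Rotates \<open>u p\<close> onto the positive real axis, so that
    \<open>Re (\<kappa> * u)\<close> attains \<open>cmod u\<close> at \<open>p\<close> and touches
    the barrier \<open>M * exp f\<close> there from below.\<close>
  define \<kappa> where "\<kappa> = cnj (sgn (u p))"
  have "u p \<noteq> 0" using Mp \<open>M > 0\<close> by auto
  then have \<kappa>: "cmod \<kappa> = 1" by (simp add: \<kappa>_def norm_sgn)
  have \<kappa>u: "\<kappa> * u p = of_real (cmod (u p))"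
  proof -
    have "\<kappa> * u p = (u p * cnj (u p)) / of_real (cmod (u p))"
      by (simp add: \<kappa>_def sgn_eq)
    also have "u p * cnj (u p) = of_real (cmod (u p)) * of_real (cmod (u p))"
      using complex_norm_square[of "u p"] by (simp add: power2_eq_square)
    finally show ?thesis using \<open>u p \<noteq> 0\<close> by simp
  qed
  let ?u1 = "circle_deriv u" and ?u2 = "(circle_deriv ^^ 2) u"
  let ?f1 = "circle_deriv f" and ?f2 = "(circle_deriv ^^ 2) f"
  define g where "g t = Re (\<kappa> * u (to_circle t)) - M * exp (f (to_circle t))" for t
  define g1 where "g1 t = Re (\<kappa> * ?u1 (to_circle t))
      - M * (exp (f (to_circle t)) * ?f1 (to_circle t))" for t
  have u1: "((\<lambda>t. u (to_circle t)) has_vector_derivative ?u1 (to_circle t)) (at t)"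
    and u2: "((\<lambda>t. ?u1 (to_circle t)) has_vector_derivative ?u2 (to_circle t)) (at t)" for t
    using C_k_on_has_vector_derivative[OF u, of 0] C_k_on_has_vector_derivative[OF u, of 1]
    by (simp_all add: numeral_2_eq_2)
  have f1: "((\<lambda>t. f (to_circle t)) has_real_derivative ?f1 (to_circle t)) (at t)"
    and f2: "((\<lambda>t. ?f1 (to_circle t)) has_real_derivative ?f2 (to_circle t)) (at t)" for t
    using C_k_on_has_vector_derivative[OF f, of 0] C_k_on_has_vector_derivative[OF f, of 1]
    by (simp_all add: numeral_2_eq_2 has_real_derivative_iff_has_vector_derivative)
  have Re: "((\<lambda>t. Re (\<kappa> * v t)) has_real_derivative Re (\<kappa> * d)) (at t)"
    if "(v has_vector_derivative d) (at t)" for v d t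
    using has_vector_derivative_mult_right[OF that, of \<kappa>]
    by (auto simp: has_vector_derivative_complex_iff)
  have g: "(g has_real_derivative g1 t) (at t)" for t
    unfolding g_def g1_def
    by (intro DERIV_diff Re u1) (auto intro!: derivative_eq_intros f1)
  \<comment> \<open>This is the second derivative of \<open>g\<close> at \<open>s\<close>, the
    second derivative of \<open>exp f\<close> being \<open>exp f * (f'' + f'^2)\<close>.\<close>
  define d where "d = Re (\<kappa> * ?u2 p) - M * exp (f p) * (?f2 p + (?f1 p)\<^sup>2)"
  have g': "(g1 has_real_derivative d) (at s)"
    unfolding g1_def d_def s
    by (intro DERIV_diff Re u2)
      (auto intro!: derivative_eq_intros f1 f2 simp: algebra_simps power2_eq_square)
  have "g s = 0" using \<kappa>u Mp by (simp add: g_def s)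
  have max: "g t \<le> g s" for t
  proof -
    have "Re (\<kappa> * u (to_circle t)) \<le> cmod (\<kappa> * u (to_circle t))" by (rule complex_Re_le_cmod)
    then show ?thesis
      using le[of "to_circle t"] by (simp add: \<open>g s = 0\<close>) (simp add: g_def norm_mult \<kappa>)
  qed
  have d: "d \<le> 0" and e1: "Re (\<kappa> * ?u1 p) = M * exp (f p) * ?f1 p"
    using derivatives_at_max[OF g g' max] by (auto simp: g1_def s)
  define m where "m = M * exp (f p)"
  have "m > 0" using \<open>M > 0\<close> by (simp add: m_def)
  have "\<kappa> * elliptic_op a b c \<epsilon> u p = z * (\<kappa> * u p)"
    by (simp add: eq)
  also have "\<dots> = z * of_real m"
    using \<kappa>u Mp by (simp add: m_def)
  finally have "Re z * m = Re (\<kappa> * elliptic_op a b c \<epsilon> u p)"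
    by simp
  also have "\<kappa> * elliptic_op a b c \<epsilon> u p =
      of_real (\<epsilon> * a p) * (\<kappa> * ?u2 p) + of_real (b p) * (\<kappa> * ?u1 p) + of_real (c p) * (\<kappa> * u p)"
    by (simp add: elliptic_op_def algebra_simps)
  also have "Re \<dots> = \<epsilon> * a p * Re (\<kappa> * ?u2 p) + b p * Re (\<kappa> * ?u1 p) + c p * Re (\<kappa> * u p)"
    by (simp only: plus_complex.simps Re_complex_of_real Im_complex_of_real times_complex.simps
        mult_zero_left diff_zero)
  \<comment> \<open>The choice of \<open>c\<close> enters here: at \<open>p\<close> the drift term
    is \<open>b * f' * M * exp f\<close>, and the potential term is its negative.\<close>
  also have "\<dots> = \<epsilon> * a p * Re (\<kappa> * ?u2 p)"
    using e1 \<kappa>u Mp by (simp add: c)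
  also have "\<dots> \<le> \<epsilon> * a p * (m * (?f2 p + (?f1 p)\<^sup>2))"
    using d a[of p] \<epsilon> by (intro mult_left_mono) (auto simp: d_def m_def)
  also have "\<dots> = (\<epsilon> * m) * (a p * (?f2 p + (?f1 p)\<^sup>2))"
    by simp
  also have "\<dots> \<le> (\<epsilon> * m) * K"
    using K[of p] \<epsilon> \<open>m > 0\<close> by (intro mult_left_mono) auto
  finally have "Re z * m \<le> (\<epsilon> * K) * m" by (simp add: mult_ac)
  then show ?thesis using \<open>m > 0\<close> by simp
qed

text \<open>Both the description defining the principal eigenvalue and the one in
  \<^const>\<open>Lim\<close> return \<open>THE r. False\<close> when nothing satisfies them. Including this value in
  the bound makes it independent of the existence of the principal eigenvalue and of its limit.\<close>

lemma Lambda_lim_le: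
  fixes a b f :: "circle \<Rightarrow> real"
  assumes a: "\<And>p. a p > 0" and a': "continuous_on UNIV a"
    and f: "C_k_on 2 f UNIV"
  shows "Lambda_lim a b (\<lambda>p. - b p * circle_deriv f p) \<le> max 0 (THE r. False)"
proof -
  let ?c = "\<lambda>p. - b p * circle_deriv f p"
  define h where "h = principal_eigenvalue a b ?c"
  define D :: real where "D = (THE r. False)"
  have "continuous_on UNIV (\<lambda>p. a p * ((circle_deriv ^^ 2) f p + (circle_deriv f p)\<^sup>2))"
    using C_k_on_imp_continuous_on[OF f, of 1] C_k_on_imp_continuous_on[OF f, of 2] a'
    by (auto intro!: continuous_intros)
  then obtain K where K: "\<And>p. a p * ((circle_deriv ^^ 2) f p + (circle_deriv f p)\<^sup>2) \<le> K"
    using continuous_attains_sup[OF compact_UNIV_circle] by blast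
  have h: "h \<epsilon> \<le> max (\<epsilon> * K) D" if "\<epsilon> > 0" for \<epsilon>
  proof -
    define P where "P r \<longleftrightarrow> is_eigenvalue a b ?c \<epsilon> (of_real r) \<and>
             (\<forall>z. is_eigenvalue a b ?c \<epsilon> z \<longrightarrow> Re z \<le> r)" for r :: real
    have hP: "h \<epsilon> = (THE r. P r)" by (simp add: h_def principal_eigenvalue_def P_def)
    show ?thesis
    proof (cases "\<exists>r. P r")
      case True
      then obtain r where r: "P r" by blast
      have "r' = r" if "P r'" for r'
        using r that unfolding P_def by (metis Re_complex_of_real antisym)
      with r have "(THE r. P r) = r" by (rule the_equality)
      moreover have "Re (of_real r) \<le> \<epsilon> * K"
        by (rule eigenvalue_Re_le[OF a that f _ K, of ?c]) (use r in \<open>auto simp: P_def\<close>)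
      ultimately show ?thesis by (simp add: hP)
    next
      case False
      then have "P = (\<lambda>r. False)" by auto
      then show ?thesis by (simp add: hP D_def)
    qed
  qed
  show ?thesis
  proof (cases "\<exists>l. (h \<longlongrightarrow> l) (at_right 0)")
    case True
    then obtain l where l: "(h \<longlongrightarrow> l) (at_right 0)" by blast
    \<comment> \<open>\<open>K\<close> depends on \<open>f\<close> but carries the factor
      \<open>\<epsilon>\<close>, so it disappears in the limit and the resulting bound is the same
      for every \<open>f\<close>.\<close>
    have "((\<lambda>\<epsilon>. max (\<epsilon> * K) D) \<longlongrightarrow> max (0 * K) D) (at_right 0)"
      by (intro tendsto_intros)
    then have "l \<le> max (0 * K) D"
      using l by (rule tendsto_le[OF trivial_limit_at_right_real])
        (auto simp: eventually_at_right_field h intro!: exI[of _ 1])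
    moreover have "Lambda_lim a b ?c = l"
      using tendsto_Lim[OF _ l] by (simp add: Lambda_lim_def h_def)
    ultimately show ?thesis by (simp add: D_def)
  next
    case False
    then have "(\<lambda>l. (h \<longlongrightarrow> l) (at_right 0)) = (\<lambda>l. False)" by auto
    then have "Lambda_lim a b ?c = D"
      by (simp add: Lambda_lim_def Topological_Spaces.Lim_def h_def D_def)
    then show ?thesis by (simp add: D_def)
  qed
qed

section \<open>Periodic bumps and a function ascending along the drift\<close>

text \<open>Squaring smooths the corner of \<open>max 0 x\<close> at the origin. It turns a
  truncated cosine into a C^1 bump, the regularity that a C^2 function asks of its
  derivative.\<close>

lemma has_real_derivative_max_0_power2:
  "((\<lambda>x::real. (max 0 x)\<^sup>2) has_real_derivative 2 * max 0 x) (at x)"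
proof -
  consider "x < 0" | "x > 0" | "x = 0" by linarith
  then show ?thesis
  proof cases
    case 1
    have "((\<lambda>x::real. 0) has_real_derivative 2 * max 0 x) (at x)" using 1 by simp
    then show ?thesis
      by (rule has_field_derivative_transform_within_open[of _ _ _ "{..<0}"]) (use 1 in auto)
  next
    case 2
    have "((\<lambda>x::real. x\<^sup>2) has_real_derivative 2 * max 0 x) (at x)"
      using 2 by (auto intro!: derivative_eq_intros)
    then show ?thesis
      by (rule has_field_derivative_transform_within_open[of _ _ _ "{0<..}"]) (use 2 in auto)
  next
    case 3
    show ?thesis
      \<comment> \<open>At the origin Caratheodory's criterion applies with slope function
        \<open>max 0 z\<close>, since \<open>(max 0 z)^2 = max 0 z * z\<close>.\<close>
      unfolding CARAT_DERIV
    proof (intro exI conjI allI)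
      show "isCont (\<lambda>z::real. max 0 z) x" by (intro continuous_intros)
    qed (auto simp: 3 power2_eq_square max_def)
  qed
qed

text \<open>The distance \<open>q\<close> from \<open>r\<close> to the nearest integer is at most
  1/2, and \<open>cos (2 * pi * q)\<close> decreases on that range. This localizes the bump modulo
  1.\<close>

lemma cos_periodic_greater_imp_close:
  assumes "cos (2 * pi * r) > cos (2 * pi * \<eta>)" "0 < \<eta>" "\<eta> \<le> 1 / 2"
  shows "\<bar>r - of_int (round r)\<bar> < \<eta>"
proof (rule ccontr)
  define q where "q = \<bar>r - of_int (round r)\<bar>"
  assume "\<not> \<bar>r - of_int (round r)\<bar> < \<eta>"
  then have q: "\<eta> \<le> q" "q \<le> 1 / 2"
    using of_int_round_abs_le[of r] by (auto simp: q_def abs_minus_commute)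
  have "cos (2 * pi * r) = cos (2 * pi * (r - of_int (round r)))"
    using cos_eq_periodic_intro[of "2 * pi * r" "2 * pi * (r - of_int (round r))" "round r"]
    by (simp add: algebra_simps)
  also have "\<dots> = cos (2 * pi * q)"
    by (auto simp: q_def abs_if) (metis cos_minus mult_minus_right minus_diff_eq)
  also have "\<dots> \<le> cos (2 * pi * \<eta>)"
    using q assms by (intro cos_monotone_0_pi_le) auto
  finally show False using assms by simp
qed

text \<open>Two translates of one periodic bump have equal integrals over a period, so their
  difference has a periodic primitive, which descends to the circle.\<close>

lemma exists_C_2_ascending:
  fixes b :: "circle \<Rightarrow> real"
  assumes b: "continuous_on UNIV b" and p: "b p > 0" and q: "b q < 0"
  obtains f where "C_k_on 2 f UNIV" "\<And>x. b x * circle_deriv f x \<ge> 0"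
    "b p * circle_deriv f p > 0" "b q * circle_deriv f q > 0"
proof -
  define s where "s = rep_circle p"
  define t where "t = rep_circle q"
  have b': "isCont (\<lambda>r. b (to_circle r)) r" for r
    using b by (simp add: continuous_on_circle_iff continuous_on_eq_continuous_at)
  obtain \<eta>1 where \<eta>1: "\<eta>1 > 0" "\<And>r. \<bar>r - s\<bar> < \<eta>1 \<Longrightarrow> b (to_circle r) > 0"
    using b'[of s, unfolded continuous_at_eps_delta, rule_format, of "b p"] p
    by (force simp: s_def dist_real_def)
  obtain \<eta>2 where \<eta>2: "\<eta>2 > 0" "\<And>r. \<bar>r - t\<bar> < \<eta>2 \<Longrightarrow> b (to_circle r) < 0"
    using b'[of t, unfolded continuous_at_eps_delta, rule_format, of "- b q"] q
    by (force simp: t_def dist_real_def)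
  \<comment> \<open>The bound 1/2 stays within the monotone range of the cosine; the other two keep
    each bump where \<open>b\<close> has a constant sign.\<close>
  define \<eta> where "\<eta> = min (1/2) (min \<eta>1 \<eta>2)"
  have \<eta>: "0 < \<eta>" "\<eta> \<le> 1/2" "\<eta> \<le> \<eta>1" "\<eta> \<le> \<eta>2" using \<eta>1 \<eta>2 by (auto simp: \<eta>_def)
  \<comment> \<open>\<open>C\<close> is positive only within distance \<open>\<eta>\<close> of the
    integers, so \<open>\<beta>\<close> is a 1-periodic bump around them.\<close>
  define C where "C r = cos (2 * pi * r) - cos (2 * pi * \<eta>)" for r
  define \<beta> where "\<beta> r = (max 0 (C r))\<^sup>2" for r
  define \<beta>' where "\<beta>' r = 2 * max 0 (C r) * (- sin (2 * pi * r) * (2 * pi))" for r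
  have \<beta>': "(\<beta> has_real_derivative \<beta>' r) (at r)" for r
  proof -
    have "(C has_real_derivative - sin (2 * pi * r) * (2 * pi)) (at r)"
      unfolding C_def by (auto intro!: derivative_eq_intros)
    from DERIV_chain2[OF has_real_derivative_max_0_power2 this]
    show ?thesis unfolding \<beta>_def \<beta>'_def .
  qed
  have cont: "continuous_on UNIV \<beta>'" "continuous_on UNIV \<beta>"
    unfolding \<beta>_def \<beta>'_def C_def by (intro continuous_intros)+
  have \<beta>_nonneg: "\<beta> r \<ge> 0" for r by (simp add: \<beta>_def)
  have \<beta>_0: "\<beta> 0 > 0"
  proof -
    have "cos (2 * pi * \<eta>) < cos 0" using \<eta> by (intro cos_monotone_0_pi) auto
    then show ?thesis by (simp add: \<beta>_def C_def)
  qed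
  have \<beta>_per: "\<beta> (r + 1) = \<beta> r" for r
    by (simp add: \<beta>_def C_def distrib_left)
  have close: "\<bar>r - of_int (round r)\<bar> < \<eta>" if "\<beta> r \<noteq> 0" for r
    using that \<eta> by (intro cos_periodic_greater_imp_close) (auto simp: \<beta>_def C_def max_def split: if_splits)
  have b_pos: "b (to_circle r) > 0" if "\<beta> (r - s) \<noteq> 0" for r
    using \<eta>1(2)[of "r - of_int (round (r - s))"] close[OF that] \<eta>
      to_circle_of_int[of r "- round (r - s)"] by (simp add: algebra_simps)
  have b_neg: "b (to_circle r) < 0" if "\<beta> (r - t) \<noteq> 0" for r
    using \<eta>2(2)[of "r - of_int (round (r - t))"] close[OF that] \<eta>
      to_circle_of_int[of r "- round (r - t)"] by (simp add: algebra_simps)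
  obtain B where B: "\<And>r. (B has_real_derivative \<beta> r) (at r)"
    using einterval_antiderivative[of "-\<infinity>" "\<infinity>" \<beta>] cont(2)
    by (auto simp: continuous_on_eq_continuous_at has_real_derivative_iff_has_vector_derivative)
  define \<phi> where "\<phi> r = B (r - s) - B (r - t)" for r
  have B_s: "((\<lambda>r. B (r - s)) has_real_derivative \<beta> (r - s)) (at r)" for r s
    using DERIV_shift[of B "\<beta> (r - s)" r "- s"] B[of "r - s"] by simp
  have \<beta>_s: "((\<lambda>r. \<beta> (r - s)) has_real_derivative \<beta>' (r - s)) (at r)" for r s
    using DERIV_shift[of \<beta> "\<beta>' (r - s)" r "- s"] \<beta>'[of "r - s"] by simp
  \<comment> \<open>Over every period \<open>B\<close> grows by the same amount, which cancels in
    \<open>\<phi>\<close>.\<close>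
  have B_per: "B (r + 1) - B r = B 1 - B 0" for r
  proof -
    have "((\<lambda>r. B (r + 1) - B r) has_real_derivative 0) (at r)" for r
      using DERIV_diff[OF B_s[of "-1" r] B[of r]] by (simp add: \<beta>_per)
    then show ?thesis
      using DERIV_isconst_all[of "\<lambda>r. B (r + 1) - B r" r 0] by simp
  qed
  have \<phi>1: "\<phi> (r + 1) = \<phi> r" for r
    using B_per[of "r - s"] B_per[of "r - t"] by (simp add: \<phi>_def algebra_simps)
  have \<phi>n: "\<phi> (r + real n) = \<phi> r" for r n
    by (induction n) (use \<phi>1[of "r + real _"] in \<open>auto simp: algebra_simps\<close>)
  have \<phi>: "\<phi> (r + of_int n) = \<phi> r" for r n
    using \<phi>n[of r "nat n"] \<phi>n[of "r + of_int n" "nat (- n)"] by (cases "n \<ge> 0") auto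
  define f where "f x = \<phi> (rep_circle x)" for x
  have f: "f (to_circle r) = \<phi> r" for r
  proof -
    have "rep_circle (to_circle r) - r \<in> \<int>" by (simp flip: to_circle_eq_iff)
    then obtain n where "rep_circle (to_circle r) = r + of_int n"
      by (elim Ints_cases) (simp add: algebra_simps)
    then show ?thesis by (simp add: f_def \<phi>)
  qed
  define \<psi> where "\<psi> r = \<beta> (r - s) - \<beta> (r - t)" for r
  have \<phi>': "((\<lambda>r. f (to_circle r)) has_vector_derivative \<psi> r) (at r)"
    and \<psi>': "(\<psi> has_vector_derivative \<beta>' (r - s) - \<beta>' (r - t)) (at r)" for r
    unfolding f \<phi>_def \<psi>_def has_real_derivative_iff_has_vector_derivative[symmetric]
    by (intro DERIV_diff B_s \<beta>_s)+
  have "continuous_on UNIV (\<lambda>r. \<beta>' (r - s) - \<beta>' (r - t))"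
    by (intro continuous_intros continuous_on_compose2[OF cont(1)]) auto
  note f2 = C_2_onI[OF \<phi>' \<psi>' this]
  have f1: "circle_deriv f (to_circle r) = \<psi> r" for r
    by (rule f2(2))
  have "C_k_on 2 f UNIV" by (rule f2(1))
  moreover have "b x * circle_deriv f x \<ge> 0" for x
  proof -
    obtain r where x: "x = to_circle r" by (metis to_circle_rep_circle)
    \<comment> \<open>At most one of the two bumps is nonzero at \<open>r\<close>, since otherwise
      \<open>b\<close> would be both positive and negative there; the surviving bump enters with the
      sign of \<open>b\<close>.\<close>
    show ?thesis
      unfolding x f1 \<psi>_def
      using b_pos[of r] b_neg[of r] \<beta>_nonneg[of "r - s"] \<beta>_nonneg[of "r - t"]
      by (cases "\<beta> (r - s) = 0"; cases "\<beta> (r - t) = 0") (auto simp: mult_nonpos_nonneg)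
  qed
  moreover have "b p * circle_deriv f p > 0"
  proof -
    have "\<beta> (s - t) = 0" using b_neg[of s] p by (force simp: s_def)
    then have "circle_deriv f p > 0" using f1[of s] \<beta>_0 by (simp add: \<psi>_def s_def)
    then show ?thesis using p by simp
  qed
  moreover have "b q * circle_deriv f q > 0"
  proof -
    have "\<beta> (t - s) = 0" using b_pos[of t] q by (force simp: t_def)
    then have "circle_deriv f q < 0" using f1[of t] \<beta>_0 by (simp add: \<psi>_def t_def)
    then show ?thesis using q by (simp add: mult_neg_neg)
  qed
  ultimately show ?thesis using that by blast
qed

section \<open>Integration against the measure and divergence of J\<close>

text \<open>The set where \<open>F > 0\<close> is an open neighbourhood of a support point and so
  has positive measure, whereas a zero integral would make it a null set.\<close>

lemma integral_pos_of_support: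
  fixes F :: "circle \<Rightarrow> real"
  assumes \<mu>: "finite_measure \<mu>" "sets \<mu> = sets borel"
    and F: "continuous_on UNIV F" "\<And>x. F x \<ge> 0"
    and x: "x \<in> measure_support \<mu>" "F x > 0"
  shows "(\<integral>y. F y \<partial>\<mu>) > 0"
proof -
  interpret finite_measure \<mu> by fact
  have meas: "F \<in> borel_measurable \<mu>"
    using borel_measurable_continuous_onI[OF F(1)] measurable_cong_sets[OF \<mu>(2) refl] by blast
  obtain M where "\<And>y. F y \<le> M"
    using continuous_attains_sup[OF compact_UNIV_circle _ F(1)] by blast
  then have int: "integrable \<mu> F"
    using F(2) meas by (intro integrable_const_bound[of _ M]) auto
  define U where "U = F -` {0<..}"
  have U: "open U" unfolding U_def using F(1) by (simp add: continuous_on_open_vimage)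
  have "emeasure \<mu> U > 0" using x U by (auto simp: measure_support_def U_def)
  moreover have "emeasure \<mu> U = 0" if "(\<integral>y. F y \<partial>\<mu>) = 0"
  proof -
    have "AE y in \<mu>. F y = 0"
      using that integral_nonneg_eq_0_iff_AE[OF int] F(2) by simp
    then have "AE y in \<mu>. y \<notin> U" by eventually_elim (simp add: U_def)
    then show ?thesis
      using U \<mu>(2) by (subst (asm) AE_iff_measurable[of U]) (auto simp: sets_eq_imp_space_eq[OF \<mu>(2)])
  qed
  moreover have "(\<integral>y. F y \<partial>\<mu>) \<ge> 0" by (simp add: F(2))
  ultimately show ?thesis by fastforce
qed

theorem proposition4p21:
  fixes a b :: "circle \<Rightarrow> real" and \<mu> :: "circle measure"
  assumes "C_k_on 2 a UNIV" and "\<forall>x. a x > 0"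
    and "C_k_on 1 b UNIV"
    and "\<exists>x. b x > 0" and "\<exists>x. b x < 0"
    and "finite {x. b x = 0}"
    and "\<forall>x. b x = 0 \<longrightarrow> (\<exists>m. zero_of_order b x m) \<or> flat_zero b x"
    and "prob_space \<mu>" and "sets \<mu> = sets borel"
    and "\<not> measure_support \<mu> \<subseteq> {x. b x = 0}"
  shows "J_functional a b \<mu> = \<infinity>"
proof -
  have a: "continuous_on UNIV a" and b: "continuous_on UNIV b"
    using C_k_on_imp_continuous_on[OF assms(1), of 0] C_k_on_imp_continuous_on[OF assms(3), of 0]
    by auto
  obtain x where x: "x \<in> measure_support \<mu>" "b x \<noteq> 0" using assms(10) by blast
  \<comment> \<open>The support point \<open>x\<close> takes the role of \<open>p\<close> or
    \<open>q\<close> according to the sign of \<open>b x\<close>; the other point is any with the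
    opposite sign.\<close>
  obtain p q where pq: "b p > 0" "b q < 0" "x = p \<or> x = q"
    using assms(4,5) x(2) by (metis linorder_neqE_linordered_idom)
  obtain f where f: "C_k_on 2 f UNIV" "\<And>x. b x * circle_deriv f x \<ge> 0"
    "b x * circle_deriv f x > 0"
    using exists_C_2_ascending[OF b pq(1,2)] pq(3) by metis
  define F where "F y = b y * circle_deriv f y" for y
  have F: "continuous_on UNIV F"
    unfolding F_def using C_k_on_imp_continuous_on[OF f(1), of 1] b by (auto intro!: continuous_intros)
  define I where "I = (\<integral>y. F y \<partial>\<mu>)"
  have "I > 0"
    unfolding I_def
    by (rule integral_pos_of_support[OF prob_space.finite_measure[OF assms(8)] assms(9) F _ x(1)])
      (use f in \<open>auto simp: F_def\<close>)
  define D :: real where "D = max 0 (THE r. False)"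
  \<comment> \<open>The potential \<open>T * b * f'\<close> has the form required by
    \<open>Lambda_lim_le\<close> for the function \<open>- T * f\<close>. Its integral is linear in
    \<open>T\<close>, while the bound \<open>D\<close> is independent of \<open>T\<close>.\<close>
  have *: "ereal (T * I - D) \<le> J_functional a b \<mu>" for T
  proof -
    let ?c = "\<lambda>y. T * F y"
    have "circle_deriv (\<lambda>p. - T * f p) y = - T * circle_deriv f y" for y
      using C_2_on_cmult(2)[OF f(1), of "- T" "rep_circle y"] by simp
    then have "?c = (\<lambda>y. - b y * circle_deriv (\<lambda>p. - T * f p) y)"
      by (simp add: F_def fun_eq_iff)
    then have "Lambda_lim a b ?c \<le> D"
      using Lambda_lim_le[OF _ a C_2_on_cmult(1)[OF f(1), of "- T"], of b] assms(2)
      by (simp add: D_def)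
    then have "ereal (T * I - D) \<le> ereal ((\<integral>y. ?c y \<partial>\<mu>) - Lambda_lim a b ?c)"
      by (simp add: I_def)
    also have "\<dots> \<le> J_functional a b \<mu>"
      unfolding J_functional_def
      by (rule SUP_upper) (auto intro!: continuous_intros F)
    finally show ?thesis .
  qed
  show ?thesis
  proof (rule ereal_top)
    fix B :: real
    \<comment> \<open>This \<open>T\<close> solves \<open>T * I - D = B\<close>.\<close>
    show "ereal B \<le> J_functional a b \<mu>"
      using *[of "(B + D) / I"] \<open>I > 0\<close> by simp
  qed
qed

end
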